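(* Let $p$ be a prime. Let $A(n) = \operatorname{ct}[P(x,y)^n Q(x,y)]$ where $P, Q \in \mathbb{Z}[x^{\pm 1}, y^{\pm 1}]$ with $$P(x,y) = \sum_{(i,j) \in \{-1,0,1\}^2} a_{i,j} x^i y^j, \quad Q(x,y) = \alpha + \beta x + \gamma y + \delta x y.$$ Suppose that $\delta = 0$, or that both $p$ is odd and $p \nmid a_{1,1}$. Suppose further that $\sigma_x = \sigma_y = 1$, where $$\sigma_x = \left(\frac{a_{1,0}^2 - 4 a_{1,-1} a_{1,1}}{p}\right), \quad \sigma_y = \left(\frac{a_{0,1}^2 - 4 a_{-1,1} a_{1,1}}{p}\right).$$ Then, for any $n \in \mathbb{Z}_{\geq 0}$ and $k \in \{0, 1, \ldots, p-1\}$, $$A(pn+k) \equiv B(n) A(k) + \begin{cases} 0, & \text{if } k < p-1, \\ A(n) - A(0) B(n), & \text{if } k = p-1, \end{cases} \pmod{p},$$ where $B(n) = \operatorname{ct}[P(x,y)^n]$.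
   Context: For a Laurent polynomial $f$, $\operatorname{ct}[f]$ denotes its constant term. For an integer $d$, $(d/p)$ denotes the Kronecker symbol; thus for odd primes $p$ it is the Legendre symbol, with $(d/p) \equiv d^{(p-1)/2} \pmod p$, while $(d/2) \equiv d \pmod 2$. *)

theory Defs
  imports
    "HOL-Number_Theory.Number_Theory"
    "HOL-Library.Poly_Mapping"
    "HOL-Library.Product_Plus"
begin

text \<open>
  The ring of bivariate Laurent polynomials over the integers is the group ring of
  \<open>\<int> \<times> \<int>\<close>: finitely supported functions on exponent pairs, with the convolution
  product of \<open>Poly_Mapping\<close>.
\<close>
type_synonym laurent2 = "(int \<times> int) \<Rightarrow>\<^sub>0 int"

text \<open>\<open>lmonom c i j\<close> is the term \<open>c x\<^sup>i y\<^sup>j\<close>.\<close>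
definition lmonom :: "int \<Rightarrow> int \<Rightarrow> int \<Rightarrow> laurent2" where
  "lmonom c i j = Poly_Mapping.single (i, j) c"

definition ct :: "laurent2 \<Rightarrow> int" where
  "ct f = Poly_Mapping.lookup f (0, 0)"

text \<open>
  The Kronecker symbol \<open>(d/p)\<close>, intended for prime \<open>p\<close> only. For \<open>p = 2\<close> it takes the
  value \<open>-1\<close> when \<open>d\<close> is 3 or 5 modulo 8, so \<open>(d/2) = 1\<close> is stronger than \<open>d\<close> being odd.
\<close>
definition kronecker :: "int \<Rightarrow> nat \<Rightarrow> int" where
  "kronecker d p =
    (if p = 2 then (if even d then 0 else if d mod 8 \<in> {1, 7} then 1 else -1)
     else Legendre d (int p))"

end

theory Submission
  imports Defs "HOL-Computational_Algebra.Polynomial"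
begin

text \<open>
  Modulo \<open>p\<close> the Laurent polynomial \<open>P\<^bsup>pn\<^esup>\<close> is \<open>P\<^sup>n\<close> evaluated at \<open>(x\<^sup>p, y\<^sup>p)\<close>. Only terms of \<open>P\<^sup>k Q\<close>
  with both exponents divisible by \<open>p\<close> can complete it to a constant term, so
  \<open>A(p n + k)\<close> is congruent to the constant term of \<open>P\<^sup>n \<Lambda>(P\<^sup>k Q)\<close>, where the Cartier operator
  \<open>\<Lambda>\<close> extracts those terms and divides their exponents by \<open>p\<close> (\<open>cartier_frobenius\<close>,
  \<open>ct_power_times\<close>).

  The exponents of \<open>P\<^sup>k Q\<close> lie between \<open>-k\<close> and \<open>k + 1\<close>. If \<open>k < p - 1\<close>, only the exponent pair
  \<open>(0, 0)\<close> qualifies, so \<open>\<Lambda>(P\<^sup>k Q)\<close> is the constant \<open>A(k)\<close> and the result is \<open>A(k) B(n)\<close>. If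
  \<open>k = p - 1\<close>, the pairs \<open>(p, 0)\<close>, \<open>(0, p)\<close> and \<open>(p, p)\<close> contribute as well
  (\<open>cartier_eq_bilinear\<close>), and the claim follows once
  \<open>\<Lambda>(P\<^bsup>p-1\<^esup> Q)\<close> is congruent to \<open>A(p - 1) - \<alpha> + Q\<close>, because \<open>A(0) = \<alpha>\<close>.

  The three extra coefficients come from the right and top edges of the exponent square of
  \<open>P\<^bsup>p-1\<^esup>\<close>. There the coefficients of \<open>P\<^bsup>p-1\<^esup>\<close> are those of the power \<open>p - 1\<close> of a
  trinomial, with coefficients \<open>a 1 (-1)\<close>, \<open>a 1 0\<close>, \<open>a 1 1\<close> in the first case (\<open>right_edge_coeff\<close>,
  \<open>top_edge_coeff\<close>). The symbols \<open>\<sigma>\<^sub>x\<close> and \<open>\<sigma>\<^sub>y\<close> belong to the discriminants of these trinomials.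
  Being \<open>1\<close>, they make the central coefficient congruent to \<open>1\<close> (\<open>central_trinomial_coeff\<close>), which
  settles \<open>\<beta>\<close> and \<open>\<gamma>\<close>. When \<open>\<delta> \<noteq> 0\<close>, the coefficient just before the central one must vanish and
  \<open>(a 1 1)\<^bsup>p-1\<^esup>\<close> must be \<open>1\<close> modulo \<open>p\<close>; both hold for odd \<open>p\<close> not dividing \<open>a 1 1\<close>, the former
  because the trinomial then splits into two distinct linear factors
  (\<open>split_trinomial_power_coeffs\<close>).
\<close>

section \<open>Powers of trinomials modulo a prime\<close>

lemma int_fermat:
  fixes c :: int
  assumes "prime p"
  shows "[c ^ p = c] (mod int p)"
proof (cases "int p dvd c")
  case True
  then show ?thesis using assms
    by (metis cong_0_iff cong_sym cong_trans dvd_power prime_gt_0_nat dvd_trans)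
next
  case False
  define b where "b = nat (c mod int p)"
  have p: "p > 0" using assms by (simp add: prime_gt_0_nat)
  have b: "[int b = c] (mod int p)" using p by (simp add: b_def)
  have "\<not> p dvd b" using False b
    by (metis cong_dvd_iff int_dvd_int_iff)
  from fermat_theorem[OF assms this] have "[int b ^ (p - 1) = 1] (mod int p)"
    by (metis cong_int_iff of_nat_1 of_nat_power)
  then have "[c ^ (p - 1) = 1] (mod int p)"
    using b by (meson cong_pow cong_sym cong_trans)
  then have "[c * c ^ (p - 1) = c * 1] (mod int p)" by (rule cong_scalar_left)
  then show ?thesis using p by (simp add: power_eq_if)
qed

lemma coprime_int_prime:
  assumes "prime p" "\<not> int p dvd c"
  shows "coprime c (int p)"
proof -
  have "prime (int p)" using assms(1) by simp
  then show ?thesis using assms(2) prime_imp_coprime coprime_commute by blast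
qed

lemma int_fermat_unit:
  fixes c :: int
  assumes "prime p" "\<not> int p dvd c"
  shows "[c ^ (p - 1) = 1] (mod int p)"
proof -
  have "[c * c ^ (p - 1) = c * 1] (mod int p)"
    using int_fermat[OF assms(1), of c] prime_gt_0_nat[OF assms(1)] by (simp add: power_eq_if)
  moreover have "coprime c (int p)" using assms by (rule coprime_int_prime)
  ultimately show ?thesis by (metis cong_mult_lcancel)
qed

text \<open>
  By Pascal's rule neighbouring entries of row \<open>p - 1\<close> add up to an inner entry of row \<open>p\<close>,
  which vanishes modulo \<open>p\<close>; hence each entry is the negative of the one before it.
\<close>

lemma choose_pred_prime_cong:
  assumes "prime p" "k < p"
  shows "[int ((p - 1) choose k) = (-1) ^ k] (mod int p)"
  using assms(2)
proof (induction k)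
  case 0
  then show ?case by simp
next
  case (Suc k)
  have "p choose Suc k = ((p - 1) choose k) + ((p - 1) choose Suc k)"
    using prime_gt_0_nat[OF assms(1)] by (metis Suc_pred' binomial_Suc_Suc)
  moreover have "p dvd p choose Suc k"
    using Suc.prems assms(1) by (intro dvd_choose_prime) auto
  ultimately have "[int ((p - 1) choose k) + int ((p - 1) choose Suc k) = 0] (mod int p)"
    by (metis cong_0_iff int_dvd_int_iff of_nat_add)
  from cong_diff[OF this Suc.IH[OF Suc_lessD[OF Suc.prems]]] show ?case by simp
qed

text \<open>
  In characteristic \<open>p\<close> the power \<open>(y - r)\<^bsup>p-1\<^esup>\<close> equals \<open>(y\<^sup>p - r\<^sup>p) / (y - r)\<close>, a geometric sum.
\<close>

lemma coeff_linear_power_pred_prime: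
  fixes r :: int
  assumes "prime p" "odd p" "i < p"
  shows "[coeff ([:- r, 1:] ^ (p - 1)) i = r ^ (p - 1 - i)] (mod int p)"
proof -
  have "[int ((p - 1) choose i) * (- r) ^ (p - 1 - i) = (-1) ^ i * (- r) ^ (p - 1 - i)] (mod int p)"
    using choose_pred_prime_cong[OF assms(1,3)] by (rule cong_scalar_right)
  moreover have "(-1) ^ i * (- r) ^ (p - 1 - i) = r ^ (p - 1 - i)"
  proof -
    have "(-1) ^ i * (- r) ^ (p - 1 - i) = ((-1) ^ i * (-1) ^ (p - 1 - i)) * r ^ (p - 1 - i)"
      by (simp add: power_minus[of r])
    also have "(-1) ^ i * (-1::int) ^ (p - 1 - i) = (-1) ^ (p - 1)"
      using assms(3) by (simp flip: power_add)
    finally show ?thesis using assms(2) by simp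
  qed
  ultimately show ?thesis using assms(3) by (simp add: coeff_linear_poly_power)
qed

lemma cong_coeff_power:
  fixes f g :: "int poly"
  assumes "\<And>i. [coeff f i = coeff g i] (mod d)"
  shows "[coeff (f ^ m) i = coeff (g ^ m) i] (mod d)"
proof -
  have "[:d:] dvd f - g"
    using assms by (simp add: const_poly_dvd_iff cong_iff_dvd_diff)
  then have "[:d:] dvd f ^ m - g ^ m" by (metis dvd_mult2 power_diff_sumr2)
  then show ?thesis by (simp add: const_poly_dvd_iff cong_iff_dvd_diff)
qed

lemma kronecker_odd_prime_square:
  assumes "prime p" "odd p" "kronecker D p = 1"
  obtains d where "[d\<^sup>2 = D] (mod int p)" "\<not> int p dvd D"
proof -
  have "p \<noteq> 2" using assms(2) by auto
  then show ?thesis using assms(3) that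
    by (auto simp: kronecker_def Legendre_def QuadRes_def cong_0_iff split: if_splits)
qed

text \<open>
  Multiplying the two geometric sums for \<open>(y - r)\<^bsup>p-1\<^esup>\<close> and \<open>(y - s)\<^bsup>p-1\<^esup>\<close> gives the central
  coefficient \<open>(r\<^sup>p - s\<^sup>p) / (r - s)\<close> and, next to it, \<open>r s (r\<^bsup>p-1\<^esup> - s\<^bsup>p-1\<^esup>) / (r - s)\<close>.
  Fermat's little theorem evaluates both. Division by \<open>r - s\<close> is where distinct roots, that is, a
  nonzero discriminant, enter.
\<close>

lemma split_power_coeffs:
  fixes r s :: int
  assumes "prime p" "odd p" "\<not> int p dvd r - s"
  shows "[coeff (([:- r, 1:] * [:- s, 1:]) ^ (p - 1)) (p - 1) = 1] (mod int p)"
    and "[coeff (([:- r, 1:] * [:- s, 1:]) ^ (p - 1)) (p - 2) = 0] (mod int p)"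
proof -
  have cop: "coprime (r - s) (int p)"
    using assms(1,3) by (rule coprime_int_prime)
  have p: "p \<ge> 3" using assms(1,2) prime_ge_2_nat[OF assms(1)] by (cases "p = 2") auto
  have prod: "[coeff (([:- r, 1:] * [:- s, 1:]) ^ (p - 1)) n
      = (\<Sum>i\<le>n. r ^ (p - 1 - i) * s ^ (p - 1 - (n - i)))] (mod int p)" if "n < p" for n
    unfolding power_mult_distrib coeff_mult
    using that by (intro cong_sum cong_mult coeff_linear_power_pred_prime assms(1,2)) auto
  show "[coeff (([:- r, 1:] * [:- s, 1:]) ^ (p - 1)) (p - 1) = 1] (mod int p)"
  proof -
    let ?S = "\<Sum>i\<le>p - 1. r ^ (p - 1 - i) * s ^ (p - 1 - (p - 1 - i))"
    have "?S = (\<Sum>i\<le>p - 1. s ^ i * r ^ (p - 1 - i))"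
      by (rule sum.cong) (simp_all only: atMost_iff diff_diff_cancel mult.commute)
    moreover have "Suc (p - 1) = p" using p by simp
    ultimately have "(s - r) * ?S = s ^ p - r ^ p"
      using diff_power_eq_sum[of s "p - 1" r] by (metis lessThan_Suc_atMost)
    then have "(r - s) * ?S = r ^ p - s ^ p" by (simp add: algebra_simps)
    moreover have "[r ^ p - s ^ p = (r - s) * 1] (mod int p)"
      using cong_diff[OF int_fermat[OF assms(1)] int_fermat[OF assms(1)]] by simp
    ultimately have "[(r - s) * ?S = (r - s) * 1] (mod int p)" by simp
    then have "[?S = 1] (mod int p)" using cop by (metis cong_mult_lcancel)
    then show ?thesis using prod[of "p - 1"] p by (auto intro: cong_trans)
  qed
  show "[coeff (([:- r, 1:] * [:- s, 1:]) ^ (p - 1)) (p - 2) = 0] (mod int p)"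
  proof -
    let ?S = "\<Sum>i\<le>p - 2. r ^ (p - 1 - i) * s ^ (p - 1 - (p - 2 - i))"
    have "?S = r * s * (\<Sum>i\<le>p - 2. s ^ i * r ^ (p - 2 - i))"
      unfolding sum_distrib_left
    proof (rule sum.cong)
      fix i assume "i \<in> {..p - 2}"
      then have "p - 1 - i = Suc (p - 2 - i)" "p - 1 - (p - 2 - i) = Suc i" using p by auto
      then show "r ^ (p - 1 - i) * s ^ (p - 1 - (p - 2 - i)) = r * s * (s ^ i * r ^ (p - 2 - i))"
        by simp
    qed simp
    moreover have "Suc (p - 2) = p - 1" using p by simp
    then have "s ^ (p - 1) - r ^ (p - 1) = (s - r) * (\<Sum>i\<le>p - 2. s ^ i * r ^ (p - 2 - i))"
      using diff_power_eq_sum[of s "p - 2" r] by (metis lessThan_Suc_atMost)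
    ultimately have "(s - r) * ?S = r * s * (s ^ (p - 1) - r ^ (p - 1))" by simp
    then have "(r - s) * ?S = s * (r * r ^ (p - 1)) - r * (s * s ^ (p - 1))"
      by (simp add: algebra_simps)
    also have "\<dots> = s * r ^ p - r * s ^ p" using p by (simp add: power_eq_if)
    finally have "[(r - s) * ?S = s * r - r * s] (mod int p)"
      using cong_diff[OF cong_scalar_left[OF int_fermat[OF assms(1), of r], of s]
                         cong_scalar_left[OF int_fermat[OF assms(1), of s], of r]] by simp
    then have "[(r - s) * ?S = (r - s) * 0] (mod int p)" by (simp add: mult.commute)
    then have "[?S = 0] (mod int p)" using cop by (metis cong_mult_lcancel)
    then show ?thesis using prod[of "p - 2"] p by (auto intro: cong_trans)
  qed
qed

text \<open>
  The quadratic formula modulo \<open>p\<close>: the equations satisfied by \<open>r\<close> and \<open>s\<close> say that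
  \<open>a y\<^sup>2 + b y + c\<close> is congruent to \<open>a (y - r) (y - s)\<close>.
\<close>

lemma quadratic_split_mod:
  assumes "prime p" "odd p" "\<not> int p dvd a" "kronecker (b\<^sup>2 - 4 * c * a) p = 1"
  obtains r s where "\<not> int p dvd r - s" "[- a * (r + s) = b] (mod int p)" "[a * (r * s) = c] (mod int p)"
proof -
  obtain d where d: "[d\<^sup>2 = b\<^sup>2 - 4 * c * a] (mod int p)" "\<not> int p dvd b\<^sup>2 - 4 * c * a"
    using kronecker_odd_prime_square[OF assms(1,2,4)] by blast
  have nd: "\<not> int p dvd d"
    using d by (metis cong_dvd_iff dvd_mult2 power2_eq_square)
  have "coprime 2 (int p)" "coprime a (int p)"
    using assms(1-3) coprime_int_prime by auto
  then have n2: "coprime (2 * a) (int p)" by simp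
  then obtain e where e: "[2 * a * e = 1] (mod int p)"
    using cong_solve_coprime_int by blast
  \<comment> \<open>Since \<open>e\<close> inverts \<open>2 * a\<close> modulo \<open>p\<close>, these are the roots of the quadratic formula.\<close>
  define r s where "r = (d - b) * e" "s = (- d - b) * e"
  have "\<not> int p dvd r - s"
  proof
    assume "int p dvd r - s"
    then have "int p dvd a * (r - s)" by simp
    moreover have "a * (r - s) = d * (2 * a * e)" by (simp add: r_s_def algebra_simps)
    moreover have "[d * (2 * a * e) = d * 1] (mod int p)" using e by (rule cong_scalar_left)
    ultimately show False using nd by (metis cong_dvd_iff mult.right_neutral)
  qed
  moreover have "[- a * (r + s) = b] (mod int p)"
  proof -
    have "- a * (r + s) = b * (2 * a * e)" by (simp add: r_s_def algebra_simps)
    then show ?thesis using cong_scalar_left[OF e, of b] by simp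
  qed
  moreover have "[a * (r * s) = c] (mod int p)"
  proof -
    have "a * (r * s) = a * e\<^sup>2 * (b\<^sup>2 - d\<^sup>2)" by (simp add: r_s_def algebra_simps power2_eq_square)
    also have "[\<dots> = a * e\<^sup>2 * (b\<^sup>2 - (b\<^sup>2 - 4 * c * a))] (mod int p)"
      by (intro cong_scalar_left cong_diff cong_refl d)
    also have "a * e\<^sup>2 * (b\<^sup>2 - (b\<^sup>2 - 4 * c * a)) = c * (2 * a * e)\<^sup>2"
      by (simp add: algebra_simps power2_eq_square)
    also have "[\<dots> = c * 1\<^sup>2] (mod int p)" by (intro cong_scalar_left cong_pow e)
    finally show ?thesis by simp
  qed
  ultimately show ?thesis using that by blast
qed

lemma split_trinomial_power_coeffs:
  fixes a b c :: int
  assumes "prime p" "odd p" "\<not> int p dvd a" "kronecker (b\<^sup>2 - 4 * c * a) p = 1"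
  shows "[coeff ([:c, b, a:] ^ (p - 1)) (p - 1) = 1] (mod int p)"
    and "[coeff ([:c, b, a:] ^ (p - 1)) (p - 2) = 0] (mod int p)"
proof -
  obtain r s where rs: "\<not> int p dvd r - s" "[- a * (r + s) = b] (mod int p)"
      "[a * (r * s) = c] (mod int p)"
    using quadratic_split_mod[OF assms] by blast
  have "[coeff [:c, b, a:] i = coeff (smult a ([:- r, 1:] * [:- s, 1:])) i] (mod int p)" for i
  proof -
    consider "i = 0" | "i = 1" | "i = 2" | "i \<ge> 3" by linarith
    then show ?thesis
    proof cases
      case 4
      then obtain j where "i = j + 3" by (metis le_add_diff_inverse2)
      then show ?thesis by (simp add: numeral_3_eq_3)
    qed (use rs in \<open>simp_all add: cong_sym_eq algebra_simps numeral_2_eq_2\<close>)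
  qed
  from cong_coeff_power[OF this]
  have *: "[coeff ([:c, b, a:] ^ (p - 1)) i
      = a ^ (p - 1) * coeff (([:- r, 1:] * [:- s, 1:]) ^ (p - 1)) i] (mod int p)" for i
    by (metis coeff_smult smult_power)
  have "[a ^ (p - 1) * coeff (([:- r, 1:] * [:- s, 1:]) ^ (p - 1)) i = 1 * y] (mod int p)"
    if "[coeff (([:- r, 1:] * [:- s, 1:]) ^ (p - 1)) i = y] (mod int p)" for i y
    by (intro cong_mult int_fermat_unit assms that)
  from cong_trans[OF * this[OF split_power_coeffs(1)[OF assms(1,2) rs(1)]]]
    cong_trans[OF * this[OF split_power_coeffs(2)[OF assms(1,2) rs(1)]]]
  show "[coeff ([:c, b, a:] ^ (p - 1)) (p - 1) = 1] (mod int p)"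
    and "[coeff ([:c, b, a:] ^ (p - 1)) (p - 2) = 0] (mod int p)" by simp_all
qed

text \<open>
  This includes two cases without a pair of roots. For \<open>p = 2\<close> the coefficient is \<open>b\<close>, which is odd.
  If \<open>p\<close> divides \<open>a\<close>, then the trinomial degenerates to \<open>c + b y\<close>, whose power has the coefficient
  \<open>b\<^bsup>p-1\<^esup>\<close>, and the discriminant condition makes \<open>b\<close> a unit.
\<close>

lemma central_trinomial_coeff:
  fixes a b c :: int
  assumes "prime p" "kronecker (b\<^sup>2 - 4 * c * a) p = 1"
  shows "[coeff ([:c, b, a:] ^ (p - 1)) (p - 1) = 1] (mod int p)"
proof (cases "p = 2")
  case True
  then have "odd b" using assms(2) by (auto simp: kronecker_def split: if_splits)
  then show ?thesis using True by (simp add: cong_iff_dvd_diff)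
next
  case False
  then have odd: "odd p" using assms(1) primes_dvd_imp_eq two_is_prime_nat by blast
  show ?thesis
  proof (cases "int p dvd a")
    case True
    obtain d where "\<not> int p dvd b\<^sup>2 - 4 * c * a"
      using kronecker_odd_prime_square[OF assms(1) odd assms(2)] by blast
    with True have nb: "\<not> int p dvd b"
      by (metis dvd_diff dvd_mult dvd_mult2 power2_eq_square)
    have "[coeff [:c, b, a:] i = coeff [:c, b:] i] (mod int p)" for i
      using True by (auto simp: coeff_pCons cong_0_iff split: nat.split)
    from cong_coeff_power[OF this, of "p - 1" "p - 1"]
    show ?thesis using int_fermat_unit[OF assms(1) nb]
      by (auto simp: coeff_linear_poly_power intro: cong_trans)
  qed (use split_trinomial_power_coeffs[OF assms(1) odd _ assms(2)] in blast)
qed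

section \<open>The Cartier operator\<close>

lemma update_eq_add_single:
  assumes "k \<notin> Poly_Mapping.keys f"
  shows "Poly_Mapping.update k c f = f + Poly_Mapping.single k c"
  using assms by (intro poly_mapping_eqI) (auto simp: lookup_update lookup_add lookup_single in_keys_iff)

lemma lookup_single_times:
  fixes f :: "'a :: ab_group_add \<Rightarrow>\<^sub>0 'b :: comm_semiring_1"
  shows "Poly_Mapping.lookup (Poly_Mapping.single k c * f) u = c * Poly_Mapping.lookup f (u - k)"
proof (induction f rule: update_induct)
  case const
  then show ?case by simp
next
  case (update f l b)
  have "(k + l = u) = (l = u - k)" by (auto simp: algebra_simps)
  with update show ?case
    by (simp add: update_eq_add_single distrib_left lookup_add mult_single lookup_single mult_when)
qed

abbreviation lcoeff :: "laurent2 \<Rightarrow> int \<Rightarrow> int \<Rightarrow> int" where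
  "lcoeff f u v \<equiv> Poly_Mapping.lookup f (u, v)"

lemma lcoeff_lmonom_times:
  "lcoeff (lmonom c i j * f) u v = c * lcoeff f (u - i) (v - j)"
  by (simp add: lmonom_def lookup_single_times)

lemma lookup_of_nat_times:
  fixes f :: laurent2
  shows "Poly_Mapping.lookup (of_nat m * f) u = int m * Poly_Mapping.lookup f u"
  using lookup_single_times[of 0 "int m" f u] by simp

text \<open>
  The ring of Laurent polynomials over the integers has characteristic zero, so congruence modulo
  \<open>p\<close> is expressed as divisibility by \<open>of_nat p\<close>.
\<close>

lemma freshmans_dream_dvd:
  fixes x y :: "'a :: comm_ring_1"
  assumes "prime p"
  shows "of_nat p dvd (x + y) ^ p - (x ^ p + y ^ p)"
proof -
  let ?t = "\<lambda>k. of_nat (p choose k) * x ^ k * y ^ (p - k)"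
  have p: "p > 0" using assms by (rule prime_gt_0_nat)
  have "(x + y) ^ p = (\<Sum>k\<le>p. ?t k)" by (rule binomial_ring)
  also have "\<dots> = sum ?t {0, p} + sum ?t ({..p} - {0, p})"
    using sum.subset_diff[of "{0, p}" "{..p}" ?t] by (simp add: add.commute)
  also have "sum ?t {0, p} = x ^ p + y ^ p" using p by (simp add: add.commute)
  finally have "(x + y) ^ p - (x ^ p + y ^ p) = sum ?t ({..p} - {0, p})" by simp
  moreover have "of_nat p dvd ?t k" if "k \<in> {..p} - {0, p}" for k
  proof -
    have "p dvd p choose k" using that assms by (intro dvd_choose_prime) auto
    then show ?thesis by (metis dvd_def dvd_mult2 of_nat_mult)
  qed
  ultimately show ?thesis by (metis (no_types, lifting) dvd_sum)
qed

text \<open>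
  The Cartier operator: keep the exponents divisible by \<open>p\<close> and divide them by \<open>p\<close>. As
  \<open>map_key\<close> is meaningful for injective maps only, this requires \<open>p > 0\<close>.
\<close>

definition cartier :: "nat \<Rightarrow> laurent2 \<Rightarrow> laurent2" where
  "cartier p = Poly_Mapping.map_key (\<lambda>(i, j). (int p * i, int p * j))"

lemma lcoeff_cartier:
  assumes "p > 0"
  shows "lcoeff (cartier p f) u v = lcoeff f (int p * u) (int p * v)"
  using assms by (simp add: cartier_def map_key.rep_eq inj_on_def split_def prod_eq_iff)

lemma cartier_add:
  assumes "p > 0"
  shows "cartier p (f + g) = cartier p f + cartier p g"
  using assms by (intro poly_mapping_eqI) (auto simp: lcoeff_cartier lookup_add)

lemma cartier_of_nat_times:
  assumes "p > 0"
  shows "cartier p (of_nat m * f) = of_nat m * cartier p f"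
  using assms by (intro poly_mapping_eqI) (auto simp: lcoeff_cartier lookup_of_nat_times)

lemma dvd_cartier:
  assumes "p > 0" "of_nat m dvd f"
  shows "of_nat m dvd cartier p f"
  using assms by (auto simp: dvd_def cartier_of_nat_times)

lemma lmonom_power: "lmonom c i j ^ m = lmonom (c ^ m) (int m * i) (int m * j)"
  by (induction m) (simp_all add: lmonom_def mult_single algebra_simps zero_prod_def[symmetric])

text \<open>
  Modulo \<open>p\<close> the power \<open>f\<^sup>p\<close> is \<open>f (x\<^sup>p, y\<^sup>p)\<close>, and the Cartier operator lets such factors pass,
  turning them into \<open>f\<close>. The congruence is additive in \<open>f\<close> because \<open>p\<close>-th powers are, so it is
  enough to check it when \<open>f\<close> is a single term, where it is Fermat's little theorem for the
  coefficient.
\<close>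

lemma cartier_frobenius:
  assumes "prime p"
  shows "of_nat p dvd cartier p (f ^ p * g) - f * cartier p g"
proof (induction f rule: update_induct)
  case const
  have "p > 0" using assms by (rule prime_gt_0_nat)
  then show ?case by (simp add: power_0_left cartier_def map_key_zero inj_on_def split_def prod_eq_iff)
next
  case (update f k c)
  have p: "p > 0" using assms by (rule prime_gt_0_nat)
  obtain i j where k: "k = (i, j)" by fastforce
  have single: "of_nat p dvd cartier p (lmonom c i j ^ p * g) - lmonom c i j * cartier p g"
  proof -
    from int_fermat[OF assms, of c] obtain d where d: "c ^ p = c + int p * d"
      by (metis cong_iff_lin cong_sym)
    have "cartier p (lmonom c i j ^ p * g) - lmonom c i j * cartier p g
        = of_nat p * (lmonom d i j * cartier p g)"
    proof (rule poly_mapping_eqI)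
      fix u :: "int \<times> int"
      obtain x y where u: "u = (x, y)" by fastforce
      show "Poly_Mapping.lookup (cartier p (lmonom c i j ^ p * g) - lmonom c i j * cartier p g) u
        = Poly_Mapping.lookup (of_nat p * (lmonom d i j * cartier p g)) u"
        using d p by (simp add: u lookup_minus lmonom_power lcoeff_cartier lcoeff_lmonom_times
            lookup_of_nat_times right_diff_distrib distrib_right mult.assoc)
    qed
    then show ?thesis by simp
  qed
  let ?m = "lmonom c i j"
  have "of_nat p dvd ((f + ?m) ^ p - (f ^ p + ?m ^ p)) * g"
    using freshmans_dream_dvd[OF assms] by (rule dvd_mult2)
  from dvd_cartier[OF p this]
  have cross: "of_nat p dvd cartier p (((f + ?m) ^ p - (f ^ p + ?m ^ p)) * g)" .
  have "cartier p ((f + ?m) ^ p * g)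
      = cartier p (((f + ?m) ^ p - (f ^ p + ?m ^ p)) * g + f ^ p * g + ?m ^ p * g)"
    by (simp add: algebra_simps)
  also have "\<dots> = cartier p (((f + ?m) ^ p - (f ^ p + ?m ^ p)) * g)
      + cartier p (f ^ p * g) + cartier p (?m ^ p * g)"
    by (simp only: cartier_add[OF p])
  finally have "cartier p ((f + ?m) ^ p * g) - (f + ?m) * cartier p g
      = cartier p (((f + ?m) ^ p - (f ^ p + ?m ^ p)) * g)
        + (cartier p (f ^ p * g) - f * cartier p g) + (cartier p (?m ^ p * g) - ?m * cartier p g)"
    by (simp only: distrib_right) simp
  then have "of_nat p dvd cartier p ((f + ?m) ^ p * g) - (f + ?m) * cartier p g"
    using cross update.IH single by (simp add: dvd_add)
  then show ?case using update.hyps by (simp add: update_eq_add_single lmonom_def k)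
qed

lemma cartier_frobenius_power:
  assumes "prime p"
  shows "of_nat p dvd cartier p (f ^ (p * n) * g) - f ^ n * cartier p g"
proof -
  have "f ^ (p * n) = (f ^ n) ^ p" by (metis mult.commute power_mult)
  then show ?thesis using cartier_frobenius[OF assms, of "f ^ n" g] by simp
qed

section \<open>Powers of polynomials with exponents in a square\<close>

definition box_poly :: "(int \<Rightarrow> int \<Rightarrow> int) \<Rightarrow> laurent2" where
  "box_poly a = (\<Sum>(i, j) \<in> {-1, 0, 1} \<times> {-1, 0, 1}. lmonom (a i j) i j)"

lemma lcoeff_box_poly_times:
  "lcoeff (box_poly a * f) u v =
    (\<Sum>i\<in>{-1, 0, 1}. \<Sum>j\<in>{-1, 0, 1}. a i j * lcoeff f (u - i) (v - j))"
  unfolding box_poly_def sum_distrib_right lookup_sum sum.cartesian_product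
  by (rule sum.cong) (auto simp: lcoeff_lmonom_times)

lemma lcoeff_one: "lcoeff (1 :: laurent2) u v = (if u = 0 \<and> v = 0 then 1 else 0)"
  by (simp add: lookup_one zero_prod_def)

lemma lcoeff_box_poly_power_outside:
  assumes "\<bar>u\<bar> > int m \<or> \<bar>v\<bar> > int m"
  shows "lcoeff (box_poly a ^ m) u v = 0"
  using assms
proof (induction m arbitrary: u v)
  case 0
  then show ?case by (auto simp: lcoeff_one)
next
  case (Suc m)
  have "lcoeff (box_poly a ^ m) (u - i) (v - j) = 0" if "i \<in> {-1, 0, 1}" "j \<in> {-1, 0, 1}" for i j
    using Suc.prems that by (intro Suc.IH) auto
  then show ?case unfolding power_Suc lcoeff_box_poly_times by (intro sum.neutral ballI) simp
qed

text \<open>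
  Centring the exponents, \<open>e m v\<close> is the coefficient of \<open>y\<^sup>v\<close> in \<open>(c y\<^sup>-\<^sup>1 + b + a y)\<^sup>m\<close>.
  Characterising it by the recursion in \<open>m\<close> allows one proof to serve both the right and the top
  edge of the square of exponents.
\<close>

lemma trinomial_recursion_coeff:
  fixes e :: "nat \<Rightarrow> int \<Rightarrow> int"
  assumes zero: "\<And>v. e 0 v = (if v = 0 then 1 else 0)"
    and suc: "\<And>m v. e (Suc m) v = c * e m (v + 1) + b * e m v + a * e m (v - 1)"
    and outside: "\<And>m v. v < - int m \<Longrightarrow> e m v = 0"
  shows "e m (int j - int m) = coeff ([:c, b, a:] ^ m) j"
proof (induction m arbitrary: j)
  case 0
  then show ?case by (simp add: zero coeff_1)
next
  case (Suc m)
  consider "j = 0" | "j = 1" | i where "j = Suc (Suc i)" by (metis One_nat_def not0_implies_Suc)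
  then show ?case
    by cases (simp_all add: suc outside algebra_simps flip: Suc.IH)
qed

text \<open>
  A term of \<open>P\<^sup>m\<close> with the maximal exponent \<open>m\<close> in \<open>x\<close> picks a term with \<open>x\<^sup>1\<close> from every factor,
  so only the right edge of \<open>P\<close> contributes. The same holds for the top edge and for the corner.
\<close>

lemma right_edge_coeff:
  "lcoeff (box_poly a ^ m) (int m) (int j - int m) = coeff ([:a 1 (-1), a 1 0, a 1 1:] ^ m) j"
  by (rule trinomial_recursion_coeff[where e = "\<lambda>m v. lcoeff (box_poly a ^ m) (int m) v"])
    (auto simp: power_Suc lcoeff_box_poly_times lcoeff_box_poly_power_outside lcoeff_one)

lemma top_edge_coeff:
  "lcoeff (box_poly a ^ m) (int j - int m) (int m) = coeff ([:a (-1) 1, a 0 1, a 1 1:] ^ m) j"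
  by (rule trinomial_recursion_coeff[where e = "\<lambda>m v. lcoeff (box_poly a ^ m) v (int m)"])
    (auto simp: power_Suc lcoeff_box_poly_times lcoeff_box_poly_power_outside lcoeff_one)

lemma corner_coeff: "lcoeff (box_poly a ^ m) (int m) (int m) = a 1 1 ^ m"
  by (induction m)
    (simp_all add: lcoeff_box_poly_times lcoeff_box_poly_power_outside lcoeff_one)

section \<open>The congruence\<close>

lemma lcoeff_times_bilinear:
  "lcoeff (f * (lmonom \<alpha> 0 0 + lmonom \<beta> 1 0 + lmonom \<gamma> 0 1 + lmonom \<delta> 1 1)) u v =
    \<alpha> * lcoeff f u v + \<beta> * lcoeff f (u - 1) v + \<gamma> * lcoeff f u (v - 1) + \<delta> * lcoeff f (u - 1) (v - 1)"
  by (simp add: mult.commute[of f] distrib_right lookup_add lcoeff_lmonom_times)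

text \<open>
  Among the multiples of \<open>p\<close> only \<open>0\<close> and \<open>p\<close> lie in the interval from \<open>1 - p\<close> to \<open>p\<close>. The
  exponents of \<open>P\<^sup>k Q\<close> stay in this interval as long as \<open>k < p\<close>.
\<close>

lemma cartier_eq_bilinear:
  assumes "p > 0"
    and outside: "\<And>u v. u \<le> - int p \<or> v \<le> - int p \<or> u > int p \<or> v > int p \<Longrightarrow> lcoeff f u v = 0"
  shows "cartier p f = lmonom (lcoeff f 0 0) 0 0 + lmonom (lcoeff f (int p) 0) 1 0
    + lmonom (lcoeff f 0 (int p)) 0 1 + lmonom (lcoeff f (int p) (int p)) 1 1"
proof (rule poly_mapping_eqI)
  fix u :: "int \<times> int"
  obtain x y where u: "u = (x, y)" by fastforce
  have range: "int p * z \<le> - int p \<or> int p * z > int p" if "z \<notin> {0, 1}" for z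
  proof -
    have "z \<le> -1 \<or> z \<ge> 2" using that by auto
    then show ?thesis
    proof
      assume "z \<le> -1"
      then have "int p * z \<le> int p * (-1)" by (intro mult_left_mono) auto
      then show ?thesis by simp
    next
      assume "z \<ge> 2"
      then have "int p * 2 \<le> int p * z" by (intro mult_left_mono) auto
      then show ?thesis using assms(1) by linarith
    qed
  qed
  show "Poly_Mapping.lookup (cartier p f) u = Poly_Mapping.lookup (lmonom (lcoeff f 0 0) 0 0
    + lmonom (lcoeff f (int p) 0) 1 0 + lmonom (lcoeff f 0 (int p)) 0 1
    + lmonom (lcoeff f (int p) (int p)) 1 1) u"
  proof (cases "x \<in> {0, 1} \<and> y \<in> {0, 1}")
    case True
    then show ?thesis
      by (auto simp: u lcoeff_cartier[OF assms(1)] lookup_add lmonom_def lookup_single)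
  next
    case False
    then have "lcoeff f (int p * x) (int p * y) = 0"
      using range[of x] range[of y] by (intro outside) blast
    with False show ?thesis
      by (auto simp: u lcoeff_cartier[OF assms(1)] lookup_add lmonom_def lookup_single)
  qed
qed

text \<open>
  A Laurent polynomial and its image under the Cartier operator have the same constant term, so
  \<open>P\<^bsup>pn\<^esup>\<close> can be moved out of the operator as \<open>P\<^sup>n\<close>.
\<close>

lemma ct_power_times:
  assumes "prime p"
  shows "[ct (P ^ (p * n) * f) = ct (P ^ n * cartier p f)] (mod int p)"
proof -
  obtain h where h: "cartier p (P ^ (p * n) * f) = P ^ n * cartier p f + of_nat p * h"
    using cartier_frobenius_power[OF assms, of P n f] by (metis add.commute diff_add_cancel dvdE)
  have "ct (P ^ (p * n) * f) = ct (cartier p (P ^ (p * n) * f))"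
    using prime_gt_0_nat[OF assms] by (simp add: ct_def lcoeff_cartier)
  also have "\<dots> = ct (P ^ n * cartier p f) + int p * ct h"
    by (simp add: h ct_def lookup_add lookup_of_nat_times)
  finally show ?thesis by (simp add: cong_iff_dvd_diff)
qed

theorem corollary4p5:
  fixes p :: nat
    and a :: "int \<Rightarrow> int \<Rightarrow> int"
    and \<alpha> \<beta> \<gamma> \<delta> :: int
    and P Q :: laurent2
    and A B :: "nat \<Rightarrow> int"
    and \<sigma>x \<sigma>y :: int
    and n k :: nat
  assumes "prime p"
    and P_def: "P = (\<Sum>(i, j) \<in> {-1, 0, 1} \<times> {-1, 0, 1}. lmonom (a i j) i j)"
    and Q_def: "Q = lmonom \<alpha> 0 0 + lmonom \<beta> 1 0 + lmonom \<gamma> 0 1 + lmonom \<delta> 1 1"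
    and A_def: "\<And>m. A m = ct (P ^ m * Q)"
    and B_def: "\<And>m. B m = ct (P ^ m)"
    and "\<delta> = 0 \<or> (odd p \<and> \<not> int p dvd a 1 1)"
    and \<sigma>x_def: "\<sigma>x = kronecker ((a 1 0)\<^sup>2 - 4 * a 1 (-1) * a 1 1) p"
    and \<sigma>y_def: "\<sigma>y = kronecker ((a 0 1)\<^sup>2 - 4 * a (-1) 1 * a 1 1) p"
    and "\<sigma>x = 1" and "\<sigma>y = 1"
    and "k \<in> {0..p - 1}"
  shows "[A (p * n + k) =
           B n * A k + (if k < p - 1 then 0 else A n - A 0 * B n)] (mod int p)"
proof -
  have p: "p \<ge> 2" using assms(1) by (rule prime_ge_2_nat)
  have P: "P = box_poly a" by (simp add: P_def box_poly_def)
  define f where "f = P ^ k * Q"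
  have lcoeff_f: "lcoeff f u v = \<alpha> * lcoeff (P ^ k) u v + \<beta> * lcoeff (P ^ k) (u - 1) v
      + \<gamma> * lcoeff (P ^ k) u (v - 1) + \<delta> * lcoeff (P ^ k) (u - 1) (v - 1)" for u v
    by (simp only: f_def Q_def lcoeff_times_bilinear)
  have k: "int k \<le> int p - 1" using assms(11) p by auto
  have outside: "lcoeff (P ^ k) u v = 0" if "\<bar>u\<bar> > int k \<or> \<bar>v\<bar> > int k" for u v
    using lcoeff_box_poly_power_outside[OF that] P by simp
  have A_n: "A n = \<alpha> * B n + \<beta> * lcoeff (P ^ n) (-1) 0 + \<gamma> * lcoeff (P ^ n) 0 (-1)
      + \<delta> * lcoeff (P ^ n) (-1) (-1)"
    by (simp add: A_def B_def ct_def Q_def lcoeff_times_bilinear)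
  have A_k: "A k = lcoeff f 0 0" by (simp add: A_def f_def ct_def)
  have A_0: "A 0 = \<alpha>"
    by (simp add: A_def ct_def Q_def lookup_add lmonom_def lookup_single)
  have "A (p * n + k) = ct (P ^ (p * n) * f)"
    by (simp add: A_def f_def power_add mult.assoc)
  also have "[\<dots> = ct (P ^ n * cartier p f)] (mod int p)"
    using assms(1) by (rule ct_power_times)
  also have "cartier p f = lmonom (A k) 0 0 + lmonom (lcoeff f (int p) 0) 1 0
    + lmonom (lcoeff f 0 (int p)) 0 1 + lmonom (lcoeff f (int p) (int p)) 1 1"
    unfolding A_k using p k by (intro cartier_eq_bilinear) (auto simp: lcoeff_f outside)
  also have "ct (P ^ n * \<dots>) = A k * B n + lcoeff f (int p) 0 * lcoeff (P ^ n) (-1) 0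
      + lcoeff f 0 (int p) * lcoeff (P ^ n) 0 (-1)
      + lcoeff f (int p) (int p) * lcoeff (P ^ n) (-1) (-1)"
    by (simp add: ct_def B_def lcoeff_times_bilinear)
  finally have A_pnk: "[A (p * n + k) = A k * B n + lcoeff f (int p) 0 * lcoeff (P ^ n) (-1) 0
      + lcoeff f 0 (int p) * lcoeff (P ^ n) 0 (-1)
      + lcoeff f (int p) (int p) * lcoeff (P ^ n) (-1) (-1)] (mod int p)" .
  show ?thesis
  proof (cases "k < p - 1")
    case True
    then have "int k < int p - 1" by linarith
    then have "lcoeff f (int p) 0 = 0" "lcoeff f 0 (int p) = 0" "lcoeff f (int p) (int p) = 0"
      by (simp_all add: lcoeff_f outside)
    with A_pnk True show ?thesis by (simp add: mult.commute)
  next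
    case False
    then have k_eq: "k = p - 1" using assms(11) by auto
    have sx: "kronecker ((a 1 0)\<^sup>2 - 4 * a 1 (-1) * a 1 1) p = 1" using assms by simp
    have sy: "kronecker ((a 0 1)\<^sup>2 - 4 * a (-1) 1 * a 1 1) p = 1" using assms by simp
    have right: "lcoeff (P ^ k) (int p - 1) (int j - int k)
        = coeff ([:a 1 (-1), a 1 0, a 1 1:] ^ (p - 1)) j" for j
      using right_edge_coeff[of a k j] p by (simp add: P k_eq of_nat_diff)
    have top: "lcoeff (P ^ k) (int j - int k) (int p - 1)
        = coeff ([:a (-1) 1, a 0 1, a 1 1:] ^ (p - 1)) j" for j
      using top_edge_coeff[of a k j] p by (simp add: P k_eq of_nat_diff)
    \<comment> \<open>Reaching \<open>x\<^sup>p\<close> through the term \<open>x\<close> of \<open>Q\<close> takes the middle of the right edge of \<open>P\<^bsup>p-1\<^esup>\<close>;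
      through \<open>x y\<close> it takes the place just below.\<close>
    have idx: "int (p - 2) - int k = -1" "int (p - 1) - int k = 0" using p by (auto simp: k_eq)
    have "[lcoeff (P ^ k) (int p - 1) 0 = 1] (mod int p)"
      using central_trinomial_coeff[OF assms(1) sx] right[of "p - 1"] unfolding idx by simp
    moreover have "[lcoeff (P ^ k) 0 (int p - 1) = 1] (mod int p)"
      using central_trinomial_coeff[OF assms(1) sy] top[of "p - 1"] unfolding idx by simp
    moreover have "[\<delta> * lcoeff (P ^ k) (int p - 1) (-1) = 0] (mod int p)"
        "[\<delta> * lcoeff (P ^ k) (-1) (int p - 1) = 0] (mod int p)"
        "[\<delta> * lcoeff (P ^ k) (int p - 1) (int p - 1) = \<delta>] (mod int p)"
    proof -
      have "[lcoeff (P ^ k) (int p - 1) (-1) = 0] (mod int p)"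
          "[lcoeff (P ^ k) (-1) (int p - 1) = 0] (mod int p)"
          "[lcoeff (P ^ k) (int p - 1) (int p - 1) = 1] (mod int p)"
        if d: "odd p" "\<not> int p dvd a 1 1"
      proof -
        show "[lcoeff (P ^ k) (int p - 1) (-1) = 0] (mod int p)"
          using split_trinomial_power_coeffs(2)[OF assms(1) d sx] right[of "p - 2"]
          unfolding idx by simp
        show "[lcoeff (P ^ k) (-1) (int p - 1) = 0] (mod int p)"
          using split_trinomial_power_coeffs(2)[OF assms(1) d sy] top[of "p - 2"]
          unfolding idx by simp
        show "[lcoeff (P ^ k) (int p - 1) (int p - 1) = 1] (mod int p)"
          using int_fermat_unit[OF assms(1) d(2)] corner_coeff[of a k] p
          by (simp add: P k_eq of_nat_diff)
      qed
      note when_d = this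
      show "[\<delta> * lcoeff (P ^ k) (int p - 1) (-1) = 0] (mod int p)"
        "[\<delta> * lcoeff (P ^ k) (-1) (int p - 1) = 0] (mod int p)"
        "[\<delta> * lcoeff (P ^ k) (int p - 1) (int p - 1) = \<delta>] (mod int p)"
        using assms(6) cong_scalar_left[OF when_d(1), of \<delta>] cong_scalar_left[OF when_d(2), of \<delta>]
          cong_scalar_left[OF when_d(3), of \<delta>] by auto
    qed
    moreover have "lcoeff f (int p) 0
          = \<beta> * lcoeff (P ^ k) (int p - 1) 0 + \<delta> * lcoeff (P ^ k) (int p - 1) (-1)"
        "lcoeff f 0 (int p)
          = \<gamma> * lcoeff (P ^ k) 0 (int p - 1) + \<delta> * lcoeff (P ^ k) (-1) (int p - 1)"
        "lcoeff f (int p) (int p) = \<delta> * lcoeff (P ^ k) (int p - 1) (int p - 1)"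
      using k by (simp_all add: lcoeff_f outside)
    ultimately have "[lcoeff f (int p) 0 = \<beta>] (mod int p)" "[lcoeff f 0 (int p) = \<gamma>] (mod int p)"
        "[lcoeff f (int p) (int p) = \<delta>] (mod int p)"
      by (metis (no_types) add_0_right cong_add cong_scalar_left mult_1_right)+
    then have "[A k * B n + lcoeff f (int p) 0 * lcoeff (P ^ n) (-1) 0
      + lcoeff f 0 (int p) * lcoeff (P ^ n) 0 (-1)
      + lcoeff f (int p) (int p) * lcoeff (P ^ n) (-1) (-1)
      = A k * B n + \<beta> * lcoeff (P ^ n) (-1) 0 + \<gamma> * lcoeff (P ^ n) 0 (-1)
      + \<delta> * lcoeff (P ^ n) (-1) (-1)] (mod int p)"
      by (intro cong_add cong_scalar_right cong_refl) simp_all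
    from cong_trans[OF A_pnk this] show ?thesis
      using False by (simp add: A_n A_0 algebra_simps)
  qed
qed

end
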